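(* Let $G$ be a group, let $\Sigma$ be a finite quasigroup, and suppose $X\subset\Sigma^G$ is a subshift closed under cellwise application of the operations of $\Sigma$. Then $X$ has equal extension counts for every $C\subset G\setminus\{e\}$. Thus, such $X$ is an avoshift for the family $\mathcal P(G\setminus\{e\})$ of all subsets of $G\setminus\{e\}$.
   Context: $G$ acts on $\Sigma^G$ by $(gx)_h=x_{g^{-1}h}$; a subshift is a closed $G$-invariant $X\subset\Sigma^G$; $X|C=\{x|C:x\in X\}$. A quasigroup is a set with a binary operation $\cdot$ such that left and right multiplications are bijections, together with the corresponding division operations. For $x\in X$ and $C\subset G\setminus\{e\}$ let $\mathcal F(x|C,e)=\{a\in\Sigma: \exists y\in X,\ y|C=x|C,\ y_e=a\}$. $X$ has equal extension counts for $C$ if $|\mathcal F(x|C,e)|$ does not depend on $x\in X$. $X$ is avo for $C$ if there is a finite $B\subset C$ with $\mathcal F(x|C,e)=\mathcal F(x|B,e)$ for all $x\in X$; $X$ is an avoshift for a family if it is avo for each member. *)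

theory Defs
  imports "HOL-Algebra.Group" "HOL-Analysis.Function_Topology"
begin

text \<open>Configurations are the elements of \<open>carrier G \<rightarrow>\<^sub>E S\<close>, i.e. functions that are
  \<open>undefined\<close> outside the carrier; likewise a pattern \<open>x|C\<close> is \<open>restrict x C\<close>.\<close>

definition shift :: "('g, 'r) monoid_scheme \<Rightarrow> 'g \<Rightarrow> ('g \<Rightarrow> 's) \<Rightarrow> ('g \<Rightarrow> 's)" where
  "shift G g x = (\<lambda>h\<in>carrier G. x (inv\<^bsub>G\<^esub> g \<otimes>\<^bsub>G\<^esub> h))"

definition subshift :: "('g, 'r) monoid_scheme \<Rightarrow> 's set \<Rightarrow> ('g \<Rightarrow> 's) set \<Rightarrow> bool" where
  "subshift G S X \<longleftrightarrow>
     closedin (product_topology (\<lambda>_. discrete_topology S) (carrier G)) X \<and>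
     (\<forall>g\<in>carrier G. \<forall>x\<in>X. shift G g x \<in> X)"

definition quasigroup :: "'s set \<Rightarrow> ('s \<Rightarrow> 's \<Rightarrow> 's) \<Rightarrow> bool" where
  "quasigroup S m \<longleftrightarrow>
     (\<forall>a\<in>S. bij_betw (\<lambda>b. m a b) S S) \<and> (\<forall>b\<in>S. bij_betw (\<lambda>a. m a b) S S)"

text \<open>In a quasigroup, \<open>left_div S m a c\<close> is the unique \<open>b \<in> S\<close> with \<open>m a b = c\<close>, and
  \<open>right_div S m c b\<close> is the unique \<open>a \<in> S\<close> with \<open>m a b = c\<close>.\<close>

definition left_div :: "'s set \<Rightarrow> ('s \<Rightarrow> 's \<Rightarrow> 's) \<Rightarrow> 's \<Rightarrow> 's \<Rightarrow> 's" where
  "left_div S m a c = inv_into S (\<lambda>b. m a b) c"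

definition right_div :: "'s set \<Rightarrow> ('s \<Rightarrow> 's \<Rightarrow> 's) \<Rightarrow> 's \<Rightarrow> 's \<Rightarrow> 's" where
  "right_div S m c b = inv_into S (\<lambda>a. m a b) c"

definition closed_cellwise ::
    "('g, 'r) monoid_scheme \<Rightarrow> ('g \<Rightarrow> 's) set \<Rightarrow> ('s \<Rightarrow> 's \<Rightarrow> 's) \<Rightarrow> bool" where
  "closed_cellwise G X f \<longleftrightarrow> (\<forall>x\<in>X. \<forall>y\<in>X. (\<lambda>g\<in>carrier G. f (x g) (y g)) \<in> X)"

definition followers ::
    "('g, 'r) monoid_scheme \<Rightarrow> 's set \<Rightarrow> ('g \<Rightarrow> 's) set \<Rightarrow> 'g set \<Rightarrow> ('g \<Rightarrow> 's) \<Rightarrow> 's set" where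
  "followers G S X C x = {a \<in> S. \<exists>y\<in>X. restrict y C = restrict x C \<and> y \<one>\<^bsub>G\<^esub> = a}"

definition equal_extension_counts ::
    "('g, 'r) monoid_scheme \<Rightarrow> 's set \<Rightarrow> ('g \<Rightarrow> 's) set \<Rightarrow> 'g set \<Rightarrow> bool" where
  "equal_extension_counts G S X C \<longleftrightarrow>
     (\<forall>x\<in>X. \<forall>y\<in>X. card (followers G S X C x) = card (followers G S X C y))"

definition avo ::
    "('g, 'r) monoid_scheme \<Rightarrow> 's set \<Rightarrow> ('g \<Rightarrow> 's) set \<Rightarrow> 'g set \<Rightarrow> bool" where
  "avo G S X C \<longleftrightarrow>
     (\<exists>B. finite B \<and> B \<subseteq> C \<and> (\<forall>x\<in>X. followers G S X C x = followers G S X B x))"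

definition avoshift ::
    "('g, 'r) monoid_scheme \<Rightarrow> 's set \<Rightarrow> ('g \<Rightarrow> 's) set \<Rightarrow> 'g set set \<Rightarrow> bool" where
  "avoshift G S X \<C> \<longleftrightarrow> subshift G S X \<and> (\<forall>C\<in>\<C>. avo G S X C)"

end

theory Submission
  imports Defs
begin

text \<open>
  Two elements \<open>x, y\<close> of \<open>X\<close> are linked by a third, the cellwise left quotient \<open>w = x \ y\<close>, for
  which \<open>x \<cdot> w = y\<close>. Right multiplication by \<open>w\<close> sends any configuration of \<open>X\<close> that agrees with
  \<open>x\<close> on \<open>C\<close> to one that agrees with \<open>y\<close> on \<open>C\<close>, and on the symbol at the identity it acts as
  right multiplication by a single element of \<open>S\<close>, which is injective. So \<open>y|C\<close> has at least as
  many extensions as \<open>x|C\<close>, and by symmetry the counts agree (\<open>equal_extension_counts_cellwise\<close>).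

  For the second claim, compactness gives, for one configuration \<open>x\<close>, a finite \<open>B \<subseteq> C\<close> with the
  same followers as \<open>C\<close> (\<open>followers_finite_window\<close>). A priori this \<open>B\<close> depends on \<open>x\<close>. Equal
  extension counts remove the dependence: for any other \<open>y\<close> the followers of \<open>y|C\<close> lie
  among those of \<open>y|B\<close>, and the two finite sets have the same sizes as for \<open>x\<close>, hence coincide.
\<close>

lemma restrict_eq_iff: "restrict y C = restrict x C \<longleftrightarrow> (\<forall>c\<in>C. y c = x c)"
  by (auto simp: restrict_def fun_eq_iff)

lemma subshift_value_in:
  assumes "subshift G S X" "x \<in> X" "g \<in> carrier G"
  shows "x g \<in> S"
proof -
  have "X \<subseteq> carrier G \<rightarrow>\<^sub>E S"
    using assms(1) closedin_subset unfolding subshift_def by fastforce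
  with assms(2,3) show ?thesis by blast
qed

lemma quasigroup_left_div:
  assumes "quasigroup S m" "a \<in> S" "c \<in> S"
  shows "m a (left_div S m a c) = c"
  using assms bij_betw_inv_into_right[of "m a" S S c]
  by (simp add: quasigroup_def left_div_def)

lemma quasigroup_closed:
  assumes "quasigroup S m" "a \<in> S" "b \<in> S"
  shows "m a b \<in> S"
  using assms by (auto simp: quasigroup_def bij_betw_def)

lemma finite_followers: "finite S \<Longrightarrow> finite (followers G S X C x)"
  by (simp add: followers_def)

lemma followers_antimono: "B \<subseteq> C \<Longrightarrow> followers G S X C x \<subseteq> followers G S X B x"
  by (auto simp: followers_def restrict_eq_iff)

text \<open>Right multiplication by the cellwise quotient \<open>x \ y\<close> carries extensions of \<open>x|C\<close>
  to extensions of \<open>y|C\<close>.\<close>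

lemma card_followers_le:
  assumes "group G" "finite S" and quasi: "quasigroup S m" and sub: "subshift G S X"
    and mult: "closed_cellwise G X m" and ldiv: "closed_cellwise G X (left_div S m)"
    and C: "C \<subseteq> carrier G" and x: "x \<in> X" and y: "y \<in> X"
  shows "card (followers G S X C x) \<le> card (followers G S X C y)"
proof -
  interpret group G by fact
  define w where "w = (\<lambda>g\<in>carrier G. left_div S m (x g) (y g))"
  have w: "w \<in> X"
    using ldiv x y unfolding closed_cellwise_def w_def by blast
  have xw: "m (x g) (w g) = y g" if "g \<in> carrier G" for g
    using that quasigroup_left_div[OF quasi] subshift_value_in[OF sub] x y
    by (simp add: w_def)
  have w1: "w \<one>\<^bsub>G\<^esub> \<in> S"
    using subshift_value_in[OF sub w] by simp
  have "inj_on (\<lambda>a. m a (w \<one>\<^bsub>G\<^esub>)) (followers G S X C x)"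
  proof (rule inj_on_subset)
    show "inj_on (\<lambda>a. m a (w \<one>\<^bsub>G\<^esub>)) S"
      using quasi w1 by (simp add: quasigroup_def bij_betw_def)
  qed (auto simp: followers_def)
  moreover have "(\<lambda>a. m a (w \<one>\<^bsub>G\<^esub>)) ` followers G S X C x \<subseteq> followers G S X C y"
  proof (clarify)
    fix a assume "a \<in> followers G S X C x"
    then obtain z where a: "a \<in> S" and z: "z \<in> X" "\<forall>c\<in>C. z c = x c" "z \<one>\<^bsub>G\<^esub> = a"
      by (auto simp: followers_def restrict_eq_iff)
    let ?zw = "\<lambda>g\<in>carrier G. m (z g) (w g)"
    have "?zw \<in> X"
      using mult z(1) w unfolding closed_cellwise_def by blast
    moreover have "\<forall>c\<in>C. ?zw c = y c"
      using C z(2) xw by auto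
    moreover have "?zw \<one>\<^bsub>G\<^esub> = m a (w \<one>\<^bsub>G\<^esub>)"
      using z(3) by simp
    ultimately show "m a (w \<one>\<^bsub>G\<^esub>) \<in> followers G S X C y"
      using quasigroup_closed[OF quasi a w1]
      unfolding followers_def restrict_eq_iff by blast
  qed
  ultimately show ?thesis
    using card_inj_on_le finite_followers \<open>finite S\<close> by metis
qed

lemma equal_extension_counts_cellwise:
  assumes "group G" "finite S" "quasigroup S m" "subshift G S X"
    and "closed_cellwise G X m" "closed_cellwise G X (left_div S m)"
    and "C \<subseteq> carrier G"
  shows "equal_extension_counts G S X C"
  unfolding equal_extension_counts_def
  using card_followers_le[OF assms] by (blast intro: order_antisym)

text \<open>If no configuration of \<open>X\<close> has symbol \<open>a\<close> at \<open>i\<close> and agrees with \<open>x\<close> on \<open>C\<close>, then the open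
  sets of configurations that differ from \<open>x\<close> at a given cell of \<open>C\<close> cover the compact set of
  configurations in \<open>X\<close> with symbol \<open>a\<close> at \<open>i\<close>; a finite subcover names the cells of \<open>B\<close>.\<close>

lemma finite_excluding_window:
  assumes "finite S" and X: "closedin (product_topology (\<lambda>_. discrete_topology S) I) X"
    and C: "C \<subseteq> I" and i: "i \<in> I"
    and none: "\<nexists>y. y \<in> X \<and> y i = a \<and> (\<forall>c\<in>C. y c = x c)"
  obtains B where "finite B" "B \<subseteq> C" "\<nexists>y. y \<in> X \<and> y i = a \<and> (\<forall>c\<in>B. y c = x c)"
proof -
  let ?T = "product_topology (\<lambda>_. discrete_topology S) I"
  define U where "U c = {y \<in> topspace ?T. y c \<in> S - {x c}}" for c
  have cont: "continuous_map ?T (discrete_topology S) (\<lambda>y. y j)" if "j \<in> I" for j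
    using continuous_map_product_projection[OF that, of "\<lambda>_. discrete_topology S"] by simp
  have "compact_space ?T"
    using \<open>finite S\<close> by (simp add: compact_space_product_topology compact_space_discrete_topology)
  moreover have "closedin ?T {y \<in> topspace ?T. y i \<in> S \<inter> {a}}"
    by (rule closedin_continuous_map_preimage[OF cont[OF i]]) simp
  ultimately have "compactin ?T (X \<inter> {y \<in> topspace ?T. y i \<in> S \<inter> {a}})"
    using X by (intro closedin_compact_space closedin_Int)
  moreover have "openin ?T (U c)" if "c \<in> C" for c
    unfolding U_def using that C by (intro openin_continuous_map_preimage[OF cont]) auto
  moreover have XT: "X \<subseteq> I \<rightarrow>\<^sub>E S"
    using closedin_subset[OF X] by simp
  have "X \<inter> {y \<in> topspace ?T. y i \<in> S \<inter> {a}} \<subseteq> \<Union> (U ` C)"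
  proof
    fix y assume "y \<in> X \<inter> {y \<in> topspace ?T. y i \<in> S \<inter> {a}}"
    then have y: "y \<in> X" "y i = a" "y \<in> topspace ?T" by auto
    then obtain c where c: "c \<in> C" "y c \<noteq> x c" using none by blast
    moreover have "y c \<in> S" using y(1) XT c(1) C by blast
    ultimately show "y \<in> \<Union> (U ` C)" using y(3) unfolding U_def by blast
  qed
  ultimately have "\<exists>F. finite F \<and> F \<subseteq> U ` C \<and> X \<inter> {y \<in> topspace ?T. y i \<in> S \<inter> {a}} \<subseteq> \<Union> F"
    by (intro compactinD) auto
  then obtain F where F: "finite F" "F \<subseteq> U ` C"
      "X \<inter> {y \<in> topspace ?T. y i \<in> S \<inter> {a}} \<subseteq> \<Union> F"
    by blast
  then obtain B where B: "B \<subseteq> C" "finite B" "F = U ` B"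
    by (meson finite_subset_image)
  have "\<nexists>y. y \<in> X \<and> y i = a \<and> (\<forall>c\<in>B. y c = x c)"
  proof clarify
    fix y assume y: "y \<in> X" "a = y i" "\<forall>c\<in>B. y c = x c"
    then have "y \<in> X \<inter> {y \<in> topspace ?T. y i \<in> S \<inter> {a}}"
      using XT i by auto
    then show False
      using F(3) B(3) y(3) by (auto simp: U_def)
  qed
  with B that show thesis by blast
qed

text \<open>As \<open>S\<close> is finite, the windows that exclude the individual non-followers have a finite union.\<close>

lemma followers_finite_window:
  assumes "group G" "finite S" and sub: "subshift G S X" and C: "C \<subseteq> carrier G"
  obtains B where "finite B" "B \<subseteq> C" "followers G S X B x = followers G S X C x"
proof -
  interpret group G by fact
  have closed: "closedin (product_topology (\<lambda>_. discrete_topology S) (carrier G)) X"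
    using sub by (simp add: subshift_def)
  let ?N = "S - followers G S X C x"
  have "\<exists>B. finite B \<and> B \<subseteq> C \<and> a \<notin> followers G S X B x" if "a \<in> ?N" for a
  proof -
    have "\<nexists>y. y \<in> X \<and> y \<one>\<^bsub>G\<^esub> = a \<and> (\<forall>c\<in>C. y c = x c)"
      using that by (auto simp: followers_def restrict_eq_iff)
    with closed
    obtain B where "finite B" "B \<subseteq> C" "\<nexists>y. y \<in> X \<and> y \<one>\<^bsub>G\<^esub> = a \<and> (\<forall>c\<in>B. y c = x c)"
      by (rule finite_excluding_window[OF \<open>finite S\<close> _ C one_closed])
    then show ?thesis
      by (auto simp: followers_def restrict_eq_iff)
  qed
  then have "\<forall>a\<in>?N. \<exists>B. finite B \<and> B \<subseteq> C \<and> a \<notin> followers G S X B x"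
    by blast
  from bchoice[OF this] obtain W
    where W: "\<forall>a\<in>?N. finite (W a) \<and> W a \<subseteq> C \<and> a \<notin> followers G S X (W a) x" ..
  let ?B = "\<Union>(W ` ?N)"
  have "finite ?B" "?B \<subseteq> C"
    using W \<open>finite S\<close> by auto
  moreover have "followers G S X ?B x \<subseteq> followers G S X C x"
  proof
    fix a assume a: "a \<in> followers G S X ?B x"
    then have "a \<in> S" by (simp add: followers_def)
    moreover have "a \<notin> ?N"
    proof
      assume "a \<in> ?N"
      then have "W a \<subseteq> ?B" by blast
      then have "a \<in> followers G S X (W a) x"
        using subsetD[OF followers_antimono a] by simp
      with W \<open>a \<in> ?N\<close> show False by blast
    qed
    ultimately show "a \<in> followers G S X C x" by blast
  qed
  ultimately show thesis
    using that[of ?B] followers_antimono[of ?B C G S X x] by blast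
qed

lemma avo_if_equal_extension_counts:
  assumes "group G" "finite S" "subshift G S X" and C: "C \<subseteq> carrier G"
    and counts: "\<And>B. B \<subseteq> C \<Longrightarrow> equal_extension_counts G S X B"
  shows "avo G S X C"
proof (cases "X = {}")
  case True
  then show ?thesis by (auto simp: avo_def)
next
  case False
  then obtain x where x: "x \<in> X" by blast
  obtain B where B: "finite B" "B \<subseteq> C" "followers G S X B x = followers G S X C x"
    using followers_finite_window[OF assms(1-4)] .
  have "followers G S X C y = followers G S X B y" if y: "y \<in> X" for y
  proof (rule card_subset_eq)
    show "card (followers G S X C y) = card (followers G S X B y)"
      using counts[of B] counts[of C] B x y unfolding equal_extension_counts_def by (metis order_refl)
  qed (simp_all add: finite_followers[OF \<open>finite S\<close>] followers_antimono[OF B(2)])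
  with B show ?thesis unfolding avo_def by blast
qed

theorem lemma4p1:
  fixes G :: "('g, 'r) monoid_scheme"
    and S :: "'s set" and m :: "'s \<Rightarrow> 's \<Rightarrow> 's"
    and X :: "('g \<Rightarrow> 's) set"
  assumes "group G"
    and "finite S" and "quasigroup S m"
    and "subshift G S X"
    and "closed_cellwise G X m"
    and "closed_cellwise G X (left_div S m)"
    and "closed_cellwise G X (right_div S m)"
  shows "(\<forall>C. C \<subseteq> carrier G - {\<one>\<^bsub>G\<^esub>} \<longrightarrow> equal_extension_counts G S X C) \<and>
         avoshift G S X (Pow (carrier G - {\<one>\<^bsub>G\<^esub>}))"
proof -
  have counts: "equal_extension_counts G S X C" if "C \<subseteq> carrier G" for C
    using equal_extension_counts_cellwise[OF assms(1-6) that] .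
  have "avo G S X C" if "C \<subseteq> carrier G" for C
    using avo_if_equal_extension_counts[OF assms(1,2,4) that] counts that by blast
  with counts \<open>subshift G S X\<close> show ?thesis
    unfolding avoshift_def by blast
qed

end
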